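(* Let $f:\mathbb{R}^d\to\mathbb{R}$ be twice differentiable and bounded from below ($\min_{\mathbf{x}} f(\mathbf{x})>-\infty$), with $L$-Lipschitz gradient and $\rho$-Lipschitz Hessian ($L,\rho>0$). Let $\epsilon>0$, $\eta=\frac{1}{4L}$, $B=\sqrt{\frac{\epsilon}{4\rho}}$, $\theta=10(\epsilon\rho\eta^2)^{1/4}\in(0,\frac{1}{10}]$, and $K=\frac{1}{\theta}$. Let $\mathbf{x}_{int}\in\mathbb{R}^d$ and $\triangle_f=f(\mathbf{x}_{int})-\min_{\mathbf{x}}f(\mathbf{x})$. Then the restarted heavy ball algorithm RHB-NC (described in the context), run from $\mathbf{x}_{int}$ with these parameters, terminates in at most $\frac{\triangle_f L^{1/2}\rho^{1/4}}{\epsilon^{7/4}}$ gradient computations, and its output $\hat{\mathbf{x}}$ satisfies $\|\nabla f(\hat{\mathbf{x}})\|\leq 242\epsilon$.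
   Context: $\|\cdot\|$ is the Euclidean norm on $\mathbb{R}^d$ and $\|\cdot\|_2$ the spectral norm. $L$-Lipschitz gradient: $\|\nabla f(\mathbf{x})-\nabla f(\mathbf{y})\|\le L\|\mathbf{x}-\mathbf{y}\|$ for all $\mathbf{x},\mathbf{y}$. $\rho$-Lipschitz Hessian: $\|\nabla^2 f(\mathbf{x})-\nabla^2 f(\mathbf{y})\|_2\le\rho\|\mathbf{x}-\mathbf{y}\|$ for all $\mathbf{x},\mathbf{y}$. Algorithm RHB-NC (parameters $\eta,B,\theta,K$; starting point $\mathbf{x}_{int}$): 1. Initialize $\mathbf{x}^{-1}=\mathbf{x}^0=\mathbf{x}_{int}$, $k=0$. 2. While $k<K$ do: (i) $\mathbf{x}^{k+1}=\mathbf{x}^k-\eta\nabla f(\mathbf{x}^k)+(1-\theta)(\mathbf{x}^k-\mathbf{x}^{k-1})$; (ii) $k\leftarrow k+1$; (iii) if $k\sum_{t=0}^{k-1}\|\mathbf{x}^{t+1}-\mathbf{x}^t\|^2>B^2$, then set $\mathbf{z}^k=\frac{\mathbf{x}^k+(1-2\theta)(1-\theta)\mathbf{x}^{k-1}}{1+(1-2\theta)(1-\theta)}$ and restart: $\mathbf{x}^{-1}=\mathbf{x}^0=\mathbf{z}^k$, $k=0$ (the iterates are re-indexed from the new starting point). 3. After the loop, let $K_0=\operatorname{argmin}_{\lfloor K/2\rfloor\le k\le K-1}\|\mathbf{x}^{k+1}-\mathbf{x}^k\|$ and output $\hat{\mathbf{x}}=\frac{1}{K_0+1}\sum_{k=0}^{K_0}\mathbf{x}^k$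 (iterates of the last round, i.e. since the last restart).
   Formalization: The number of gradient computations is bounded by the maximum of the stated bound and ⌈K⌉: every run makes at least ⌈K⌉ gradient computations, so the stated bound fails when it is below ⌈K⌉ (e.g. f = 0, where it is 0). *)

theory Defs
  imports "HOL-Analysis.Analysis" "HOL-Library.While_Combinator"
begin

definition grad :: "('a::real_inner \<Rightarrow> real) \<Rightarrow> 'a \<Rightarrow> 'a" where
  "grad f x = (THE D. GDERIV f x :> D)"

definition hess :: "(real^'d \<Rightarrow> real) \<Rightarrow> real^'d \<Rightarrow> real^'d^'d" where
  "hess f x = jacobian (grad f) (at x)"

definition twice_differentiable :: "(real^'d \<Rightarrow> real) \<Rightarrow> bool" where
  "twice_differentiable f \<longleftrightarrow>
     (\<forall>x. f differentiable (at x)) \<and> (\<forall>x. grad f differentiable (at x))"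

definition spectral_norm :: "real^'n^'m \<Rightarrow> real" where
  "spectral_norm A = onorm ((*v) A)"

definition lipschitz_hessian :: "real \<Rightarrow> (real^'d \<Rightarrow> real) \<Rightarrow> bool" where
  "lipschitz_hessian \<rho> f \<longleftrightarrow>
     (\<forall>x y. spectral_norm (hess f x - hess f y) \<le> \<rho> * norm (x - y))"

text \<open>
  In a state, \<open>iter s\<close> holds the iterates since the last restart; only its values at the
  indices from \<open>-1\<close> up to \<open>idx s\<close> are meaningful. The field \<open>grads s\<close> counts the gradient
  evaluations since the very beginning of the run, and is not reset by a restart.
\<close>

record 'a rhb_state =
  iter :: "int \<Rightarrow> 'a"
  idx :: nat
  grads :: nat

definition rhb_start :: "'a \<Rightarrow> nat \<Rightarrow> 'a rhb_state" where
  "rhb_start x0 n = \<lparr>iter = (\<lambda>_. x0), idx = 0, grads = n\<rparr>"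

text \<open>One pass through the loop body; it evaluates the gradient map \<open>g\<close> exactly once.\<close>

definition rhb_step ::
  "('a::real_normed_vector \<Rightarrow> 'a) \<Rightarrow> real \<Rightarrow> real \<Rightarrow> real \<Rightarrow> 'a rhb_state \<Rightarrow> 'a rhb_state" where
  "rhb_step g \<eta> B \<theta> s =
     (let x = iter s;
          i = int (idx s);
          x' = x(i + 1 := x i - \<eta> *\<^sub>R g (x i) + (1 - \<theta>) *\<^sub>R (x i - x (i - 1)));
          k = idx s + 1;
          n = grads s + 1;
          c = (1 - 2 * \<theta>) * (1 - \<theta>)
      in if real k * (\<Sum>t<k. (norm (x' (int t + 1) - x' (int t)))\<^sup>2) > B\<^sup>2
         then rhb_start ((1 / (1 + c)) *\<^sub>R (x' (int k) + c *\<^sub>R x' (int k - 1))) n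
         else \<lparr>iter = x', idx = k, grads = n\<rparr>)"

text \<open>The result is \<open>None\<close> iff the loop does not terminate.\<close>

definition rhb_nc ::
  "('a::real_normed_vector \<Rightarrow> 'a) \<Rightarrow> real \<Rightarrow> real \<Rightarrow> real \<Rightarrow> real \<Rightarrow> 'a \<Rightarrow> 'a rhb_state option" where
  "rhb_nc g \<eta> B \<theta> K xint =
     while_option (\<lambda>s. real (idx s) < K) (rhb_step g \<eta> B \<theta>) (rhb_start xint 0)"

text \<open>
  The possible outputs computed from a final state. There may be more than one since the
  minimum that determines \<open>K0\<close> may be attained at several indices.
\<close>

definition rhb_outputs :: "real \<Rightarrow> 'a::real_normed_vector rhb_state \<Rightarrow> 'a set" where
  "rhb_outputs K s =
     {(1 / real (K0 + 1)) *\<^sub>R (\<Sum>k\<le>K0. iter s (int k)) | K0.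
        is_arg_min (\<lambda>k. norm (iter s (int k + 1) - iter s (int k)))
          (\<lambda>k. \<lfloor>K / 2\<rfloor> \<le> int k \<and> real k \<le> K - 1) K0}"

end

theory Submission
  imports Defs
begin

text \<open>
  Write \<open>d k = x k - x (k - 1)\<close> for the displacements of an epoch, so that
  \<open>\<eta> * grad f (x k) = (1 - \<theta>) d k - d (k + 1)\<close>. Two facts carry the theorem.

  Every restart lowers \<open>f\<close> by a fixed amount. With friction \<open>\<theta>\<close>, the heavy ball loses energy of the order
  \<open>\<theta> / \<eta>\<close> times \<open>\<Sum>k. norm (d k)^2\<close> (lemma \<open>epoch_descent\<close>). To see this for a nonconvex function, the change
  of \<open>f\<close> along the epoch is written by the trapezoidal rule as a sum of inner products of gradients with
  displacements (\<open>trapezoid_rule_error\<close>; this is where the Lipschitz Hessian enters), in which the gradients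
  are replaced by displacements. What remains is a telescoping kinetic energy and a friction term, which is
  negative because consecutive displacements are positively correlated on average
  (\<open>sum_consecutive_inner_ge\<close>), whatever the sign of the curvature. The restart test ensures that the
  sum of squares exceeds \<open>B^2 / n\<close> after \<open>n\<close> steps, with \<open>n\<close> at most about \<open>1 / \<theta>\<close>, so an epoch gains of the order \<open>\<theta>^2 B^2 / \<eta>\<close>, that is,
  \<open>\<epsilon>^(3/2) / \<rho>^(1/2)\<close>. Dividing \<open>\<Delta>\<close> by this and multiplying by the length of an epoch gives
  the number of gradient evaluations (\<open>rhb_nc_epoch_accounting\<close>).

  In the last epoch the average of the iterates is nearly stationary. The test never triggers, so they stay within \<open>B\<close> of the
  start, so the gradient at their average differs from the average of their gradients by at most
  \<open>4 \<rho> B^2 = \<epsilon>\<close> (\<open>gradient_at_average\<close>). The average gradient telescopes to the last displacement plus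
  \<open>\<theta>\<close> times the total displacement, divided by \<open>\<eta>\<close> and by the number of iterates (\<open>average_gradient_le\<close>). The
  index of the last iterate was chosen to make the former small, and the energy bound controls the latter.
  Together this gives \<open>225 \<epsilon> + \<epsilon>\<close>.
\<close>

section \<open>Gradients, linearization and quadrature\<close>

lemma gderiv_grad:
  fixes f :: "'a::euclidean_space \<Rightarrow> real"
  assumes "f differentiable (at x)"
  shows "GDERIV f x :> grad f x"
proof -
  obtain f' where f': "(f has_derivative f') (at x)"
    using assms by (auto simp: differentiable_def)
  interpret linear f' by (rule has_derivative_linear[OF f'])
  have "f' = (\<lambda>h. h \<bullet> (\<Sum>b\<in>Basis. f' b *\<^sub>R b))"
  proof
    fix h
    have "f' h = f' (\<Sum>b\<in>Basis. (h \<bullet> b) *\<^sub>R b)" by (simp add: euclidean_representation)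
    also have "\<dots> = (\<Sum>b\<in>Basis. (h \<bullet> b) * f' b)" by (simp add: sum scale)
    also have "\<dots> = h \<bullet> (\<Sum>b\<in>Basis. f' b *\<^sub>R b)"
      by (simp add: inner_sum_right mult.commute)
    finally show "f' h = h \<bullet> (\<Sum>b\<in>Basis. f' b *\<^sub>R b)" .
  qed
  with f' have D: "GDERIV f x :> (\<Sum>b\<in>Basis. f' b *\<^sub>R b)"
    by (simp add: gderiv_def)
  have "D' = D''" if "GDERIV f x :> D'" "GDERIV f x :> D''" for D' D''
  proof -
    have "(\<lambda>h. h \<bullet> D') = (\<lambda>h. h \<bullet> D'')"
      using that unfolding gderiv_def by (rule has_derivative_unique)
    then show ?thesis by (metis inner_commute vector_eq_ldot)
  qed
  then show ?thesis unfolding grad_def using D by (metis (mono_tags, lifting) theI)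
qed

lemma segment_derivative:
  fixes f :: "'a::real_inner \<Rightarrow> real"
  assumes "\<And>x. GDERIV f x :> g x"
  shows "((\<lambda>t. f (x + t *\<^sub>R v)) has_real_derivative g (x + t *\<^sub>R v) \<bullet> v) (at t)"
proof -
  have "((\<lambda>t. f (x + t *\<^sub>R v)) has_derivative (\<lambda>h. (h *\<^sub>R v) \<bullet> g (x + t *\<^sub>R v))) (at t)"
    by (rule has_derivative_compose[where g = f and f = "\<lambda>t. x + t *\<^sub>R v"])
      (use assms[of "x + t *\<^sub>R v"] in \<open>auto simp: gderiv_def intro!: derivative_eq_intros\<close>)
  then show ?thesis
    by (simp add: has_field_derivative_def inner_commute mult.commute[of _ "_ \<bullet> _"] mult_commute_abs)
qed

text \<open>
  The mean value theorem gives the quadratic upper bound with constant \<open>L\<close>. Integrating the gradient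
  would give \<open>L / 2\<close>, but the factor is absorbed by the slack of the descent estimate.
\<close>

lemma lipschitz_gradient_upper_bound:
  fixes f :: "'a::real_inner \<Rightarrow> real"
  assumes "\<And>x. GDERIV f x :> g x" and "L-lipschitz_on UNIV g"
  shows "f (x + v) \<le> f x + g x \<bullet> v + L * (norm v)\<^sup>2"
proof -
  obtain t where t: "0 < t" "t < 1" "f (x + 1 *\<^sub>R v) - f (x + 0 *\<^sub>R v) = (1 - 0) * (g (x + t *\<^sub>R v) \<bullet> v)"
    using MVT2[of 0 1 "\<lambda>t. f (x + t *\<^sub>R v)" "\<lambda>t. g (x + t *\<^sub>R v) \<bullet> v"]
      segment_derivative[OF assms(1), of x v] by auto
  have L: "0 \<le> L" using assms(2) by (rule lipschitz_on_nonneg)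
  have "(g (x + t *\<^sub>R v) - g x) \<bullet> v \<le> norm (g (x + t *\<^sub>R v) - g x) * norm v"
    by (rule norm_cauchy_schwarz)
  also have "\<dots> \<le> (L * norm (t *\<^sub>R v)) * norm v"
    using lipschitz_on_normD[OF assms(2), of "x + t *\<^sub>R v" x]
    by (intro mult_right_mono) auto
  also have "\<dots> \<le> (L * norm v) * norm v"
    using t L by (intro mult_right_mono mult_left_mono) (auto intro: mult_left_le_one_le)
  finally show ?thesis using t(3) by (simp add: inner_diff_left power2_eq_square)
qed

lemma hess_derivative:
  assumes "twice_differentiable f"
  shows "(grad f has_derivative (\<lambda>h. hess f x *v h)) (at x)"
  using assms jacobian_works unfolding twice_differentiable_def hess_def by blast

lemma gradient_linearization:
  assumes "twice_differentiable f" and "lipschitz_hessian \<rho> f" and "0 \<le> \<rho>"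
  shows "norm (grad f y - grad f x - hess f x *v (y - x)) \<le> \<rho> * (norm (y - x))\<^sup>2"
proof -
  have "norm (grad f y - grad f x - hess f x *v (y - x)) \<le> norm (y - x) * (\<rho> * norm (y - x))"
  proof (rule differentiable_bound_linearization[where S = "closed_segment x y" and f' = "\<lambda>x h. hess f x *v h"])
    show "x + t *\<^sub>R (y - x) \<in> closed_segment x y" if "t \<in> {0..1}" for t
      using that by (auto simp: closed_segment_def algebra_simps intro!: exI[of _ t])
    show "(grad f has_derivative (*v) (hess f z)) (at z within closed_segment x y)" for z
      using hess_derivative[OF assms(1)] has_derivative_at_withinI by blast
    show "onorm ((*v) (hess f z) - (*v) (hess f x)) \<le> \<rho> * norm (y - x)"
      if "z \<in> closed_segment x y" for z
    proof -
      have "onorm ((*v) (hess f z) - (*v) (hess f x)) = spectral_norm (hess f z - hess f x)"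
        unfolding spectral_norm_def
        by (intro arg_cong[where f = onorm] ext) (simp add: matrix_vector_mult_diff_rdistrib)
      also have "\<dots> \<le> \<rho> * norm (z - x)" using assms(2) by (simp add: lipschitz_hessian_def)
      also have "\<dots> \<le> \<rho> * norm (y - x)"
        using segment_bound(1)[OF that] assms(3)  by (simp add: mult_left_mono)
      finally show ?thesis .
    qed
  qed auto
  then show ?thesis by (simp add: power2_eq_square mult_ac)
qed

text \<open>
  The error \<open>\<psi> t\<close> of the trapezoidal rule on \<open>[x, x + t v]\<close> has as derivative half the linearization
  error of the gradient at \<open>x\<close>, seen from the moving base point \<open>x + t v\<close>. That error is quadratic in
  the length, so the trapezoidal error is cubic. The estimate speaks of gradients only, which the
  heavy ball recursion expresses through displacements.
\<close>

lemma trapezoid_rule_error: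
  assumes "twice_differentiable f" and "lipschitz_hessian \<rho> f" and "0 \<le> \<rho>"
  shows "\<bar>f (x + v) - f x - (grad f x + grad f (x + v)) \<bullet> v / 2\<bar> \<le> \<rho> / 2 * norm v ^ 3"
proof -
  let ?w = "\<lambda>t. x + t *\<^sub>R v"
  define \<psi> where "\<psi> t = f (?w t) - t * ((grad f x + grad f (?w t)) \<bullet> v) / 2" for t
  define \<psi>' where "\<psi>' t = (grad f (?w t) - grad f x - t *\<^sub>R (hess f (?w t) *v v)) \<bullet> v / 2" for t
  have g: "GDERIV f x :> grad f x" for x
    using assms(1) gderiv_grad by (auto simp: twice_differentiable_def)
  have h: "((\<lambda>t. grad f (?w t)) has_derivative (\<lambda>h. hess f (?w t) *v (h *\<^sub>R v))) (at t)" for t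
    by (rule has_derivative_compose[where g = "grad f" and f = "\<lambda>t. x + t *\<^sub>R v"])
      (auto intro!: derivative_eq_intros hess_derivative[OF assms(1)])
  have h': "((\<lambda>t. grad f (?w t) \<bullet> v) has_real_derivative (hess f (?w t) *v v) \<bullet> v) (at t)" for t
  proof -
    have "((\<lambda>t. grad f (?w t) \<bullet> v) has_derivative (\<lambda>h. (hess f (?w t) *v (h *\<^sub>R v)) \<bullet> v)) (at t)"
      by (rule has_derivative_inner_left[OF h])
    then show ?thesis
      by (simp add: has_field_derivative_def matrix_vector_mult_scaleR mult_commute_abs)
  qed
  have D: "(\<psi> has_real_derivative \<psi>' t) (at t)" for t
    unfolding \<psi>_def \<psi>'_def inner_add_left
    by (auto intro!: derivative_eq_intros segment_derivative[OF g] h'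
        simp: inner_diff_left inner_add_left field_simps)
  obtain t where t: "0 < t" "t < 1" "\<psi> 1 - \<psi> 0 = (1 - 0) * \<psi>' t"
    using MVT2[of 0 1 \<psi> \<psi>'] D by auto
  let ?r = "grad f x - grad f (?w t) - hess f (?w t) *v (x - ?w t)"
  have "\<bar>\<psi>' t\<bar> = \<bar>?r \<bullet> v\<bar> / 2"
    unfolding \<psi>'_def by (simp add: matrix_vector_mult_scaleR inner_diff_left flip: scaleR_minus_left)
  also have "\<bar>?r \<bullet> v\<bar> \<le> norm ?r * norm v" by (rule Cauchy_Schwarz_ineq2)
  also have "norm ?r \<le> \<rho> * (norm (x - ?w t))\<^sup>2" by (rule gradient_linearization[OF assms])
  also have "(norm (x - ?w t))\<^sup>2 \<le> (norm v)\<^sup>2"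
    using t by (intro power_mono) (auto intro: mult_left_le_one_le)
  finally have "\<bar>\<psi>' t\<bar> \<le> \<rho> * (norm v)\<^sup>2 * norm v / 2"
    using assms(3) by (simp add: mult_left_mono mult_right_mono)
  moreover have "f (x + v) - f x - (grad f x + grad f (x + v)) \<bullet> v / 2 = \<psi>' t"
    using t(3) by (simp add: \<psi>_def)
  ultimately show ?thesis by (simp add: power3_eq_cube power2_eq_square mult_ac)
qed

section \<open>Energy decay of heavy ball trajectories\<close>

lemma sum_norm_squared_le:
  fixes f :: "nat \<Rightarrow> 'a::real_normed_vector"
  shows "(norm (\<Sum>k<n. f k))\<^sup>2 \<le> real n * (\<Sum>k<n. (norm (f k))\<^sup>2)"
proof -
  have "(norm (\<Sum>k<n. f k))\<^sup>2 \<le> (\<Sum>k<n. norm (f k))\<^sup>2"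
    by (intro power_mono norm_sum) auto
  also have "\<dots> \<le> (\<Sum>k<n. (norm (f k))\<^sup>2) * card {..<n}"
    by (rule sum_squared_le_sum_of_squares)
  finally show ?thesis by (simp add: mult.commute)
qed

text \<open>
  The recursion is written in position and velocity form, \<open>d k\<close> being the last displacement
  \<open>x k - x (k - 1)\<close>, and holds for the first \<open>n\<close> steps only, since an epoch of the algorithm is finite.
\<close>

locale heavy_ball =
  fixes g :: "'a::real_inner \<Rightarrow> 'a" and \<eta> \<theta> :: real and x d :: "nat \<Rightarrow> 'a" and n :: nat
  assumes eta_pos: "0 < \<eta>" and theta_pos: "0 < \<theta>" and theta_le: "\<theta> \<le> 1 / 10"
    and d_0: "d 0 = 0"
    and x_Suc: "k < n \<Longrightarrow> x (Suc k) = x k + d (Suc k)"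
    and d_Suc: "k < n \<Longrightarrow> d (Suc k) = (1 - \<theta>) *\<^sub>R d k - \<eta> *\<^sub>R g (x k)"
begin

lemma iterate_eq_sum: "k \<le> n \<Longrightarrow> x k - x 0 = (\<Sum>t<k. d (Suc t))"
  by (induction k) (auto simp: x_Suc algebra_simps)

lemma distance_squared_le:
  "k \<le> n \<Longrightarrow> (norm (x k - x 0))\<^sup>2 \<le> real k * (\<Sum>t<k. (norm (d (Suc t)))\<^sup>2)"
  by (simp add: iterate_eq_sum sum_norm_squared_le)

text \<open>
  The trajectory cannot zigzag with period two. Eliminating the gradients from two consecutive steps
  gives \<open>d (k + 1) + (1 - \<theta>) d (k - 1) = (2 - \<theta>) d k - h\<close>, where \<open>h\<close> is \<open>\<eta>\<close> times a gradient difference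
  and hence at most a quarter of \<open>d k\<close>. Pairing with \<open>d k\<close> and summing shows that consecutive
  displacements are positively correlated on average, up to a boundary term.
\<close>

lemma sum_consecutive_inner_ge:
  assumes lip: "\<And>y z. \<eta> * norm (g y - g z) \<le> norm (y - z) / 4"
  shows "(\<Sum>k<n. d k \<bullet> d (Suc k)) \<ge> (\<Sum>k<n. (norm (d k))\<^sup>2) / 2 - (norm (d n))\<^sup>2 / 4"
proof (cases n)
  case 0
  then show ?thesis by (simp add: d_0)
next
  case (Suc m)
  define c where "c k = d k \<bullet> d (Suc k)" for k
  have step: "c (Suc j) + (1 - \<theta>) * c j \<ge> (7/4 - \<theta>) * (norm (d (Suc j)))\<^sup>2" if "Suc j < n" for j
  proof -
    define h where "h = \<eta> *\<^sub>R (g (x (Suc j)) - g (x j))"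
    have "h = ((1 - \<theta>) *\<^sub>R d (Suc j) - d (Suc (Suc j))) - ((1 - \<theta>) *\<^sub>R d j - d (Suc j))"
      using d_Suc[of "Suc j"] d_Suc[of j] that unfolding h_def scaleR_diff_right[of \<eta>] by simp
    then have "d (Suc (Suc j)) = (2 - \<theta>) *\<^sub>R d (Suc j) - (1 - \<theta>) *\<^sub>R d j - h"
      by (simp add: algebra_simps scaleR_2)
    then have "c (Suc j) + (1 - \<theta>) * c j = (2 - \<theta>) * (norm (d (Suc j)))\<^sup>2 - d (Suc j) \<bullet> h"
      by (simp add: c_def inner_simps power2_norm_eq_inner inner_commute)
    moreover have "d (Suc j) \<bullet> h \<le> (norm (d (Suc j)))\<^sup>2 / 4"
    proof -
      have "norm h \<le> norm (d (Suc j)) / 4"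
        using lip[of "x (Suc j)" "x j"] eta_pos that by (simp add: h_def x_Suc)
      then have "norm (d (Suc j)) * norm h \<le> norm (d (Suc j)) * (norm (d (Suc j)) / 4)"
        by (intro mult_left_mono) auto
      then show ?thesis
        using norm_cauchy_schwarz[of "d (Suc j)" h] by (simp add: power2_eq_square)
    qed
    ultimately show ?thesis by (simp add: algebra_simps)
  qed
  have "(2 - \<theta>) * (\<Sum>k<Suc j. c k) - (1 - \<theta>) * c j \<ge> (7/4 - \<theta>) * (\<Sum>k<Suc j. (norm (d k))\<^sup>2)"
    if "j < n" for j
    using that
  proof (induction j)
    case 0
    then show ?case by (simp add: c_def d_0)
  next
    case (Suc j)
    then show ?case using step[of j] by (simp add: algebra_simps)
  qed
  from this[of m] have main: "(2 - \<theta>) * (\<Sum>k<n. c k) \<ge> (7/4 - \<theta>) * (\<Sum>k<n. (norm (d k))\<^sup>2) + (1 - \<theta>) * c m"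
    by (simp add: Suc)
  let ?S = "\<Sum>k<n. (norm (d k))\<^sup>2" and ?D = "(norm (d n))\<^sup>2"
  have "\<bar>c m\<bar> \<le> norm (d m) * norm (d n)" by (simp add: c_def Suc Cauchy_Schwarz_ineq2)
  also have "\<dots> \<le> ((norm (d m))\<^sup>2 + ?D) / 2"
    using sum_squares_bound[of "norm (d m)" "norm (d n)"] by simp
  also have "(norm (d m))\<^sup>2 \<le> ?S" by (simp add: Suc sum_nonneg)
  finally have "- (?S + ?D) / 2 \<le> c m" by simp
  then have "(1 - \<theta>) * (- (?S + ?D) / 2) \<le> (1 - \<theta>) * c m"
    using theta_le by (intro mult_left_mono) auto
  with main have "(2 - \<theta>) * (\<Sum>k<n. c k) \<ge> (5/4 - \<theta>/2) * ?S - (1 - \<theta>)/2 * ?D"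
    by (simp add: field_simps)
  moreover have "(5/4 - \<theta>/2) * ?S - (1 - \<theta>)/2 * ?D - (2 - \<theta>) * (?S / 2 - ?D / 4) = ?S / 4 + \<theta>/4 * ?D"
    by (simp add: field_simps)
  moreover have "?S / 4 + \<theta>/4 * ?D \<ge> 0" using theta_pos by (simp add: sum_nonneg)
  ultimately have "(2 - \<theta>) * (\<Sum>k<n. c k) \<ge> (2 - \<theta>) * (?S / 2 - ?D / 4)" by linarith
  then show ?thesis using theta_le unfolding c_def by simp
qed

text \<open>
  Two ideas combine here. The trapezoidal rule replaces \<open>f (x m) - f (x 0)\<close> by
  \<open>\<Sum>k. g (x k) \<bullet> (d k + d (k + 1)) / 2\<close> up to a boundary term and cubic errors, and the recursion turns
  the \<open>k\<close>-th summand into \<open>norm (d k)^2 - norm (d (k + 1))^2 - \<theta> (norm (d k)^2 + d k \<bullet> d (k + 1))\<close>, divided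
  by \<open>2 \<eta>\<close>. The first two terms telescope. The friction term is bounded below through
  \<open>sum_consecutive_inner_ge\<close>, for positive and negative curvature alike.

  The boundary term is \<open>g (x m) \<bullet> d n / 2\<close>, that is, the linear estimate of \<open>f\<close> halfway along the last
  step. The restart point lies halfway up to \<open>O(\<theta>)\<close>, so \<open>f\<close> is compared with its linear estimate from
  \<open>x m\<close> by smoothness; the last displacement may be long, but the kinetic term \<open>norm (d n)^2 / (2 \<eta>)\<close>
  that the telescoping leaves over pays for the quadratic error.
\<close>

lemma epoch_descent:
  fixes f :: "'a \<Rightarrow> real" and \<rho> B :: real
  defines "c \<equiv> (1 - 2 * \<theta>) * (1 - \<theta>)"
  assumes lip: "\<And>y z. \<eta> * norm (g y - g z) \<le> norm (y - z) / 4"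
    and smooth: "\<And>y v. f (y + v) \<le> f y + g y \<bullet> v + (norm v)\<^sup>2 / (4 * \<eta>)"
    and trapezoid: "\<And>y v. f (y + v) - f y \<le> (g y + g (y + v)) \<bullet> v / 2 + \<rho> / 2 * norm v ^ 3"
    and rho: "0 \<le> \<rho>" and coupling: "\<rho> * B * \<eta> \<le> \<theta> / 20"
    and short: "\<And>k. k < n \<Longrightarrow> norm (d k) \<le> B"
    and n: "0 < n"
  shows "f ((1 / (1 + c)) *\<^sub>R (x n + c *\<^sub>R x (n - 1)))
    \<le> f (x 0) - \<theta> / (2 * \<eta>) * (\<Sum>k<n. (norm (d (Suc k)))\<^sup>2)"
proof -
  obtain m where m: "n = Suc m" using n by (cases n) auto
  define S where "S = (\<Sum>k<n. (norm (d k))\<^sup>2)"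
  define D where "D = (norm (d n))\<^sup>2"
  have S_m: "(norm (d m))\<^sup>2 \<le> S" by (simp add: S_def m sum_nonneg)
  have nonneg: "0 \<le> S" "0 \<le> D" by (auto simp: S_def D_def sum_nonneg)
  have total: "(\<Sum>k<n. (norm (d (Suc k)))\<^sup>2) = S + D"
    using sum.lessThan_Suc_shift[of "\<lambda>k. (norm (d k))\<^sup>2" n] by (simp add: S_def D_def d_0)
  have force: "\<eta> * (g (x k) \<bullet> v) = (1 - \<theta>) * (d k \<bullet> v) - d (Suc k) \<bullet> v" if "k < n" for k v
  proof -
    have "\<eta> *\<^sub>R g (x k) = (1 - \<theta>) *\<^sub>R d k - d (Suc k)" using d_Suc[OF that] by simp
    then have "(\<eta> *\<^sub>R g (x k)) \<bullet> v = ((1 - \<theta>) *\<^sub>R d k - d (Suc k)) \<bullet> v" by simp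
    then show ?thesis by (simp add: inner_simps)
  qed
  \<comment> \<open>Each step contributes half of its trapezoidal sum to the gradient at either end.\<close>
  have telescope: "f (x j) + g (x j) \<bullet> d (Suc j) / 2 - f (x 0)
       \<le> (\<Sum>k<Suc j. g (x k) \<bullet> (d k + d (Suc k))) / 2 + (\<Sum>k<Suc j. \<rho> / 2 * norm (d k) ^ 3)"
    if "j < n" for j
    using that
  proof (induction j)
    case 0
    then show ?case by (simp add: d_0)
  next
    case (Suc j)
    then show ?case using trapezoid[of "x j" "d (Suc j)"]
      by (simp add: x_Suc inner_add_left inner_add_right add_divide_distrib)
  qed
  have cubic: "(\<Sum>k<n. \<rho> / 2 * norm (d k) ^ 3) \<le> \<rho> * B / 2 * S"
    unfolding S_def sum_distrib_left
  proof (intro sum_mono)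
    fix k assume "k \<in> {..<n}"
    then have "norm (d k) * (norm (d k))\<^sup>2 \<le> B * (norm (d k))\<^sup>2"
      by (intro mult_right_mono short) auto
    then have "\<rho> / 2 * (norm (d k) * (norm (d k))\<^sup>2) \<le> \<rho> / 2 * (B * (norm (d k))\<^sup>2)"
      using rho by (intro mult_left_mono) auto
    then show "\<rho> / 2 * norm (d k) ^ 3 \<le> \<rho> * B / 2 * (norm (d k))\<^sup>2"
      by (simp add: power3_eq_cube power2_eq_square mult_ac)
  qed
  have work: "\<eta> * (\<Sum>k<n. g (x k) \<bullet> (d k + d (Suc k))) = - D - \<theta> * (S + (\<Sum>k<n. d k \<bullet> d (Suc k)))"
  proof -
    have "\<eta> * (\<Sum>k<n. g (x k) \<bullet> (d k + d (Suc k)))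
        = (\<Sum>k<n. (norm (d k))\<^sup>2 - (norm (d (Suc k)))\<^sup>2 - \<theta> * ((norm (d k))\<^sup>2 + d k \<bullet> d (Suc k)))"
      unfolding sum_distrib_left
    proof (intro sum.cong refl)
      fix k assume "k \<in> {..<n}"
      then show "\<eta> * (g (x k) \<bullet> (d k + d (Suc k)))
          = (norm (d k))\<^sup>2 - (norm (d (Suc k)))\<^sup>2 - \<theta> * ((norm (d k))\<^sup>2 + d k \<bullet> d (Suc k))"
        by (subst force)
          (auto simp: inner_simps power2_norm_eq_inner inner_commute[of "d (Suc k)" "d k"] algebra_simps)
    qed
    also have "\<dots> = - D - \<theta> * (S + (\<Sum>k<n. d k \<bullet> d (Suc k)))"
      unfolding sum_subtractf total by (simp add: sum.distrib S_def flip: sum_distrib_left)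
    finally show ?thesis .
  qed
  \<comment> \<open>The restart point is the fraction \<open>s\<close> of the last step, with \<open>s = 1/2 + O(\<theta>)\<close>.\<close>
  define s where "s = 1 / (1 + c)"
  have c: "18/25 \<le> c" "c \<le> 1" "1 - c \<le> 3 * \<theta>"
  proof -
    have "(4/5) * (9/10) \<le> c" unfolding c_def using theta_le by (intro mult_mono) auto
    then show "18/25 \<le> c" by simp
    show "c \<le> 1" unfolding c_def using theta_pos theta_le by (intro mult_le_one) auto
    show "1 - c \<le> 3 * \<theta>" unfolding c_def using theta_pos by (simp add: algebra_simps)
  qed
  have s: "s \<le> 25/43" "0 \<le> s" "0 \<le> s - 1/2" "s - 1/2 \<le> 7/8 * \<theta>"
  proof -
    show "s \<le> 25/43" "0 \<le> s" "0 \<le> s - 1/2" using c by (auto simp: s_def field_simps)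
    have "s - 1/2 = (1 - c) / (2 * (1 + c))" using c by (simp add: s_def field_simps)
    also have "\<dots> \<le> (3 * \<theta>) / (2 * (1 + 18/25))" using c theta_pos by (intro frac_le) auto
    also have "\<dots> \<le> 7/8 * \<theta>" using theta_pos by simp
    finally show "s - 1/2 \<le> 7/8 * \<theta>" .
  qed
  have z: "(1 / (1 + c)) *\<^sub>R (x n + c *\<^sub>R x (n - 1)) = x m + s *\<^sub>R d n"
  proof -
    have "x n + c *\<^sub>R x (n - 1) = (1 + c) *\<^sub>R x m + d n" by (simp add: m x_Suc algebra_simps)
    then show ?thesis using c by (simp add: s_def scaleR_add_right)
  qed
  \<comment> \<open>The last step is downhill up to the momentum it inherits: \<open>u v - v^2\<close> is at most \<open>u^2 / 4\<close>.\<close>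
  have "\<eta> * (g (x m) \<bullet> d n) \<le> S / 4"
  proof -
    have "\<eta> * (g (x m) \<bullet> d n) = (1 - \<theta>) * (d m \<bullet> d n) - D"
      by (simp add: force m D_def power2_norm_eq_inner)
    also have "(1 - \<theta>) * (d m \<bullet> d n) \<le> (1 - \<theta>) * (norm (d m) * norm (d n))"
      using theta_le by (intro mult_left_mono norm_cauchy_schwarz) auto
    also have "\<dots> \<le> norm (d m) * norm (d n)"
      using theta_pos theta_le by (intro mult_left_le_one_le) auto
    also have "norm (d m) * norm (d n) - D \<le> (norm (d m))\<^sup>2 / 4"
      using zero_le_power2[of "norm (d m) / 2 - norm (d n)"]
      by (simp add: D_def power2_diff power_divide)
    finally show ?thesis using S_m by simp
  qed
  then have "(s - 1/2) * (\<eta> * (g (x m) \<bullet> d n)) \<le> (s - 1/2) * (S / 4)"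
    using s by (intro mult_left_mono) auto
  also have "\<dots> \<le> (7/8 * \<theta>) * (S / 4)" using s nonneg by (intro mult_right_mono) auto
  finally have offset: "(s - 1/2) * (\<eta> * (g (x m) \<bullet> d n)) \<le> 7/32 * \<theta> * S" by simp
  have corr: "\<theta> * (S + (\<Sum>k<n. d k \<bullet> d (Suc k))) \<ge> \<theta> * (3/2 * S - D / 4)"
    using sum_consecutive_inner_ge[OF lip] theta_pos
    by (intro mult_left_mono) (auto simp: S_def D_def)
  define w where "w = (s - 1/2) * (\<eta> * (g (x m) \<bullet> d n))"
  define F where "F = \<eta> * (f (x m) + (g (x m) \<bullet> d n) / 2)"
  have "\<eta> * f (x m + s *\<^sub>R d n) \<le> \<eta> * (f (x m) + s * (g (x m) \<bullet> d n) + s\<^sup>2 * D / (4 * \<eta>))"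
    using smooth[of "x m" "s *\<^sub>R d n"] eta_pos
    by (intro mult_left_mono) (auto simp: D_def power_mult_distrib)
  also have "\<dots> = F + w + s\<^sup>2 * D / 4"
    using eta_pos by (simp add: F_def w_def field_simps)
  finally have last: "\<eta> * f (x m + s *\<^sub>R d n) \<le> F + w + s\<^sup>2 * D / 4" .
  define P where "P = \<theta> * (S + (\<Sum>k<n. d k \<bullet> d (Suc k)))"
  have "F \<le> \<eta> * (f (x 0) + (\<Sum>k<n. g (x k) \<bullet> (d k + d (Suc k))) / 2 + \<rho> * B / 2 * S)"
    unfolding F_def using telescope[of m] cubic eta_pos
    by (intro mult_left_mono) (auto simp: m)
  also have "\<dots> = \<eta> * f (x 0) + (\<eta> * (\<Sum>k<n. g (x k) \<bullet> (d k + d (Suc k)))) / 2 + (\<rho> * B * \<eta>) * S / 2"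
    by (simp add: distrib_left mult_ac)
  also have "\<dots> = \<eta> * f (x 0) - D / 2 - P / 2 + (\<rho> * B * \<eta>) * S / 2"
    by (simp add: work P_def diff_divide_distrib)
  also have "\<dots> \<le> \<eta> * f (x 0) - D / 2 - P / 2 + \<theta> / 20 * S / 2"
    using coupling nonneg by (intro add_left_mono divide_right_mono mult_right_mono) auto
  finally have "F \<le> \<eta> * f (x 0) - D / 2 - P / 2 + \<theta> / 20 * S / 2" .
  moreover have "3/2 * (\<theta> * S) - \<theta> * D / 4 \<le> P" using corr by (simp add: P_def algebra_simps)
  moreover have "w \<le> 7/32 * (\<theta> * S)" using offset by (simp add: w_def)
  ultimately have "\<eta> * f (x m + s *\<^sub>R d n)
      \<le> \<eta> * f (x 0) - D / 2 + \<theta> * D / 8 - 81/160 * (\<theta> * S) + s\<^sup>2 * D / 4"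
    using last by linarith
  also have "\<dots> \<le> \<eta> * f (x 0) - \<theta> / 2 * (S + D)"
  proof -
    have "s\<^sup>2 \<le> (25/43)\<^sup>2" using s by (intro power_mono) auto
    then have "s\<^sup>2 * D \<le> 2/5 * D" using nonneg by (intro mult_right_mono) (auto simp: power2_eq_square)
    moreover have "\<theta> * D \<le> 1/10 * D" using nonneg theta_le by (intro mult_right_mono) auto
    moreover have "0 \<le> \<theta> * S" using nonneg theta_pos by simp
    moreover have "\<theta> / 2 * (S + D) = \<theta> * S / 2 + \<theta> * D / 2"
      by (simp add: distrib_left)
    ultimately show ?thesis using nonneg by linarith
  qed
  also have "\<dots> = \<eta> * (f (x 0) - \<theta> / (2 * \<eta>) * (S + D))"
    using eta_pos by (simp add: right_diff_distrib)
  finally have "\<eta> * f (x m + s *\<^sub>R d n) \<le> \<eta> * (f (x 0) - \<theta> / (2 * \<eta>) * (S + D))" .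
  then show ?thesis unfolding z total using eta_pos by simp
qed

end

section \<open>Averaged gradients\<close>

text \<open>
  When the gradient is linearized at the average itself, the first-order terms cancel, since the
  deviations from an average sum to zero. Only the quadratic errors survive, and the points lie within \<open>2 B\<close> of
  their average.
\<close>

lemma gradient_at_average:
  fixes f :: "real^'d \<Rightarrow> real" and x :: "nat \<Rightarrow> real^'d"
  assumes "twice_differentiable f" and "lipschitz_hessian \<rho> f" and rho: "0 \<le> \<rho>"
    and m: "0 < m" and near: "\<And>k. k < m \<Longrightarrow> norm (x k - x 0) \<le> B"
  defines "y \<equiv> (1 / real m) *\<^sub>R (\<Sum>k<m. x k)"
  shows "norm (grad f y) \<le> norm (\<Sum>k<m. grad f (x k)) / real m + 4 * \<rho> * B\<^sup>2"
proof -
  define r where "r k = grad f (x k) - grad f y - hess f y *v (x k - y)" for k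
  have my: "real m *\<^sub>R y = (\<Sum>k<m. x k)" using m by (simp add: y_def)
  have "real m *\<^sub>R (y - x 0) = (\<Sum>k<m. x k - x 0)"
    using my by (simp add: scaleR_diff_right sum_subtractf sum_constant_scaleR del: sum_constant)
  then have "real m * norm (y - x 0) = norm (\<Sum>k<m. x k - x 0)"
    by (metis abs_of_nat norm_scaleR)
  also have "\<dots> \<le> real m * B"
    using sum_norm_le[of "{..<m}" "\<lambda>k. x k - x 0" "\<lambda>_. B"] near by simp
  finally have y: "norm (y - x 0) \<le> B" using m by simp
  have r: "norm (r k) \<le> \<rho> * (2 * B)\<^sup>2" if "k < m" for k
  proof -
    have "norm (x k - y) \<le> norm (x k - x 0) + norm (y - x 0)"
      using norm_triangle_ineq4[of "x k - x 0" "y - x 0"] by simp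
    also have "\<dots> \<le> 2 * B" using y near[OF that] by simp
    finally have "\<rho> * (norm (x k - y))\<^sup>2 \<le> \<rho> * (2 * B)\<^sup>2"
      using rho by (intro mult_left_mono power_mono) auto
    then show ?thesis
      using gradient_linearization[OF assms(1,2) rho, of "x k" y] by (simp add: r_def)
  qed
  have "(\<Sum>k<m. hess f y *v (x k - y)) = hess f y *v (\<Sum>k<m. x k - y)"
    by (rule linear_sum[symmetric, OF matrix_vector_mul_linear])
  also have "(\<Sum>k<m. x k - y) = 0" using my by (simp add: sum_subtractf sum_constant_scaleR del: sum_constant)
  finally have "real m *\<^sub>R grad f y = (\<Sum>k<m. grad f (x k)) - (\<Sum>k<m. r k)"
    by (simp add: r_def sum_subtractf sum_constant_scaleR del: sum_constant)
  then have "real m * norm (grad f y) = norm ((\<Sum>k<m. grad f (x k)) - (\<Sum>k<m. r k))"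
    by (metis abs_of_nat norm_scaleR)
  also have "\<dots> \<le> norm (\<Sum>k<m. grad f (x k)) + norm (\<Sum>k<m. r k)"
    by (rule norm_triangle_ineq4)
  also have "norm (\<Sum>k<m. r k) \<le> real m * (\<rho> * (2 * B)\<^sup>2)"
    using sum_norm_le[of "{..<m}" r "\<lambda>_. \<rho> * (2 * B)\<^sup>2"] r by simp
  finally show ?thesis using m by (simp add: field_simps)
qed

context heavy_ball
begin

text \<open>
  Because \<open>\<eta> g (x k)\<close> is a difference of consecutive displacements up to friction, the gradients telescope.
  This is why the algorithm outputs an average, and why it chooses the last index by a short step.
\<close>

lemma sum_gradients:
  "j < n \<Longrightarrow> \<eta> *\<^sub>R (\<Sum>k<Suc j. g (x k)) = - d (Suc j) - \<theta> *\<^sub>R (x j - x 0)"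
proof (induction j)
  case 0
  then show ?case by (simp add: d_Suc d_0)
next
  case (Suc j)
  have "\<eta> *\<^sub>R (\<Sum>k<Suc (Suc j). g (x k)) = \<eta> *\<^sub>R (\<Sum>k<Suc j. g (x k)) + \<eta> *\<^sub>R g (x (Suc j))"
    by (simp add: scaleR_add_right)
  also have "\<dots> = - d (Suc j) - \<theta> *\<^sub>R (x j - x 0) + ((1 - \<theta>) *\<^sub>R d (Suc j) - d (Suc (Suc j)))"
    using Suc d_Suc[of "Suc j"] by simp
  also have "\<dots> = - d (Suc (Suc j)) - \<theta> *\<^sub>R (x (Suc j) - x 0)"
    using Suc.prems by (simp add: x_Suc algebra_simps)
  finally show ?case .
qed

lemma distance_le:
  assumes "real n * (\<Sum>t<n. (norm (d (Suc t)))\<^sup>2) \<le> B\<^sup>2" and "0 \<le> B" and "j \<le> n"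
  shows "norm (x j - x 0) \<le> B"
proof -
  have "(norm (x j - x 0))\<^sup>2 \<le> real j * (\<Sum>t<j. (norm (d (Suc t)))\<^sup>2)"
    by (rule distance_squared_le[OF assms(3)])
  also have "\<dots> \<le> real n * (\<Sum>t<n. (norm (d (Suc t)))\<^sup>2)"
    using assms(3) by (intro mult_mono sum_mono2) (auto simp: sum_nonneg)
  also note assms(1)
  finally show ?thesis using assms(2) by (rule power2_le_imp_le)
qed

text \<open>
  By \<open>sum_gradients\<close> there are two terms to bound. The displacement \<open>d (j + 1)\<close> is no longer than any step
  indexed by \<open>I\<close>, hence at most their root mean square, which is of order \<open>\<theta> B\<close>. The distance \<open>x j - x 0\<close> is bounded by
  Cauchy--Schwarz over the first \<open>j\<close> steps rather than by \<open>B\<close>, which gains the factor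
  \<open>sqrt (j / n)\<close>. Each term, after division by \<open>\<eta> (j + 1)\<close>, is a multiple of \<open>\<theta>^2 B / \<eta>\<close>.
\<close>

lemma average_gradient_le:
  assumes budget: "real n * (\<Sum>t<n. (norm (d (Suc t)))\<^sup>2) \<le> B\<^sup>2" and B: "0 \<le> B"
    and n: "1 / \<theta> \<le> real n"
    and j: "j < n" "1 / (2 * \<theta>) \<le> real (Suc j)"
    and I: "I \<subseteq> {..<n}" "9 / (20 * \<theta>) \<le> real (card I)"
    and minimal: "\<And>k. k \<in> I \<Longrightarrow> norm (d (Suc j)) \<le> norm (d (Suc k))"
  shows "norm (\<Sum>k<Suc j. g (x k)) / real (Suc j) \<le> 9/2 * \<theta>\<^sup>2 * B / \<eta>"
proof -
  let ?S = "\<Sum>t<n. (norm (d (Suc t)))\<^sup>2"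
  have "1 / \<theta> * ?S \<le> real n * ?S" using n by (intro mult_right_mono sum_nonneg) auto
  also note budget
  finally have S: "?S \<le> \<theta> * B\<^sup>2" using theta_pos by (simp add: field_simps)
  have "9 / (20 * \<theta>) * (norm (d (Suc j)))\<^sup>2 \<le> real (card I) * (norm (d (Suc j)))\<^sup>2"
    using I by (intro mult_right_mono) auto
  also have "\<dots> \<le> (\<Sum>k\<in>I. (norm (d (Suc k)))\<^sup>2)"
    using minimal by (intro sum_bounded_below power_mono) auto
  also have "\<dots> \<le> ?S" using I by (intro sum_mono2) auto
  also note S
  finally have "(norm (d (Suc j)))\<^sup>2 \<le> 20/9 * (\<theta> * B)\<^sup>2"
    using theta_pos by (simp add: field_simps power2_eq_square)
  also have "\<dots> \<le> 9/4 * (\<theta> * B)\<^sup>2" by (intro mult_right_mono) auto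
  also have "\<dots> = (3/2 * \<theta> * B)\<^sup>2" by (simp add: power2_eq_square)
  finally have d: "norm (d (Suc j)) \<le> 3/2 * \<theta> * B"
    by (rule power2_le_imp_le) (use theta_pos B in auto)
  have "(norm (x j - x 0))\<^sup>2 \<le> real j * (\<Sum>t<j. (norm (d (Suc t)))\<^sup>2)"
    using j by (intro distance_squared_le) auto
  also have "\<dots> \<le> real (Suc j) * ?S"
    using j by (intro mult_mono sum_mono2 sum_nonneg) auto
  also have "\<dots> \<le> real (Suc j) * (\<theta> * B\<^sup>2)" using S by (intro mult_left_mono) auto
  also have "\<dots> = (real (Suc j) * \<theta> * B\<^sup>2) * 1" by simp
  also have "\<dots> \<le> (real (Suc j) * \<theta> * B\<^sup>2) * (2 * \<theta> * real (Suc j))"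
    using j theta_pos by (intro mult_left_mono) (auto simp: field_simps)
  also have "\<dots> = 2 * (\<theta> * B * real (Suc j))\<^sup>2" by (simp add: power2_eq_square)
  also have "\<dots> \<le> 9/4 * (\<theta> * B * real (Suc j))\<^sup>2" by (intro mult_right_mono) auto
  also have "\<dots> = (3/2 * \<theta> * B * real (Suc j))\<^sup>2" by (simp add: power2_eq_square)
  finally have dist: "norm (x j - x 0) \<le> 3/2 * \<theta> * B * real (Suc j)"
    by (rule power2_le_imp_le) (use theta_pos B in auto)
  have "\<eta> * norm (\<Sum>k<Suc j. g (x k)) = norm (\<eta> *\<^sub>R (\<Sum>k<Suc j. g (x k)))"
    using eta_pos by simp
  also have "\<dots> = norm (- d (Suc j) - \<theta> *\<^sub>R (x j - x 0))" using sum_gradients[OF j(1)] by simp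
  also have "\<dots> \<le> norm (d (Suc j)) + \<theta> * norm (x j - x 0)"
    using norm_triangle_ineq4[of "- d (Suc j)" "\<theta> *\<^sub>R (x j - x 0)"] theta_pos by simp
  also have "\<dots> \<le> 3/2 * \<theta> * B * 1 + \<theta> * (3/2 * \<theta> * B * real (Suc j))"
    using d dist theta_pos by (intro add_mono mult_left_mono) auto
  also have "\<dots> \<le> 3/2 * \<theta> * B * (2 * \<theta> * real (Suc j)) + \<theta> * (3/2 * \<theta> * B * real (Suc j))"
    using j theta_pos B by (intro add_mono mult_left_mono) (auto simp: field_simps)
  also have "\<dots> = 9/2 * \<theta>\<^sup>2 * B * real (Suc j)" by (simp add: power2_eq_square algebra_simps)
  finally show ?thesis using eta_pos by (simp add: field_simps del: of_nat_Suc)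
qed

end

section \<open>Epochs and restarts\<close>

definition path_energy :: "(int \<Rightarrow> 'a::real_normed_vector) \<Rightarrow> nat \<Rightarrow> real" where
  "path_energy x n = (\<Sum>t<n. (norm (x (int t + 1) - x (int t)))\<^sup>2)"

definition heavy_ball_epoch ::
  "('a::real_normed_vector \<Rightarrow> 'a) \<Rightarrow> real \<Rightarrow> real \<Rightarrow> (int \<Rightarrow> 'a) \<Rightarrow> nat \<Rightarrow> bool" where
  "heavy_ball_epoch g \<eta> \<theta> x n \<longleftrightarrow> x (- 1) = x 0 \<and>
     (\<forall>k<n. x (int k + 1) =
        x (int k) - \<eta> *\<^sub>R g (x (int k)) + (1 - \<theta>) *\<^sub>R (x (int k) - x (int k - 1)))"

definition restart_point :: "real \<Rightarrow> (int \<Rightarrow> 'a::real_vector) \<Rightarrow> nat \<Rightarrow> 'a" where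
  "restart_point \<theta> x n = (let c = (1 - 2 * \<theta>) * (1 - \<theta>) in
     (1 / (1 + c)) *\<^sub>R (x (int n) + c *\<^sub>R x (int n - 1)))"

text \<open>
  An epoch starts from equal iterates at the indices \<open>-1\<close> and \<open>0\<close>, that is, with velocity zero.
\<close>

lemma heavy_ball_epoch_imp_heavy_ball:
  assumes "heavy_ball_epoch g \<eta> \<theta> x n" and "0 < \<eta>" "0 < \<theta>" "\<theta> \<le> 1 / 10"
  shows "heavy_ball g \<eta> \<theta> (\<lambda>k. x (int k)) (\<lambda>k. x (int k) - x (int k - 1)) n"
  using assms by unfold_locales (auto simp: heavy_ball_epoch_def add.commute[of 1])

lemma path_energy_eq:
  "path_energy x n = (\<Sum>t<n. (norm (x (int (Suc t)) - x (int (Suc t) - 1)))\<^sup>2)"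
  by (simp add: path_energy_def add.commute)

lemma path_energy_cong:
  "(\<And>k. k \<le> int n \<Longrightarrow> x k = y k) \<Longrightarrow> path_energy x n = path_energy y n"
  unfolding path_energy_def by (intro sum.cong) auto

lemma heavy_ball_epoch_extend:
  assumes "heavy_ball_epoch g \<eta> \<theta> x n"
  shows "heavy_ball_epoch g \<eta> \<theta> (x(int n + 1 := x (int n) - \<eta> *\<^sub>R g (x (int n))
    + (1 - \<theta>) *\<^sub>R (x (int n) - x (int n - 1)))) (Suc n)"
  using assms by (auto simp: heavy_ball_epoch_def less_Suc_eq)

text \<open>
  The loop invariant charges every completed epoch with a decrease \<open>\<delta>\<close> of \<open>f\<close> and at most \<open>\<lceil>K\<rceil>\<close>
  gradient evaluations. As \<open>f\<close> is bounded below, the number \<open>N\<close> of restarts is bounded, hence so is the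
  gradient counter; since it grows with every pass, the loop ends. At a restart the energy test
  triggers for the first time in the epoch, so \<open>descent\<close> may use that it did not trigger one step earlier.
\<close>

lemma rhb_nc_epoch_accounting:
  fixes g :: "'a::real_normed_vector \<Rightarrow> 'a" and f :: "'a \<Rightarrow> real" and xint :: 'a and \<eta> B \<theta> K \<delta> b :: real
  assumes descent: "\<And>x n. heavy_ball_epoch g \<eta> \<theta> x n \<Longrightarrow> 0 < n \<Longrightarrow> n \<le> nat \<lceil>K\<rceil> \<Longrightarrow>
      real (n - 1) * path_energy x (n - 1) \<le> B\<^sup>2 \<Longrightarrow> B\<^sup>2 < real n * path_energy x n \<Longrightarrow>
      f (restart_point \<theta> x n) \<le> f (x 0) - \<delta>"
    and delta: "0 < \<delta>" and bound: "\<And>y. b \<le> f y" and K: "0 < K"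
  obtains s N where "rhb_nc g \<eta> B \<theta> K xint = Some s"
    and "heavy_ball_epoch g \<eta> \<theta> (iter s) (idx s)" and "idx s = nat \<lceil>K\<rceil>"
    and "real (idx s) * path_energy (iter s) (idx s) \<le> B\<^sup>2"
    and "real N * \<delta> \<le> f xint - b" and "grads s \<le> (N + 1) * nat \<lceil>K\<rceil>"
proof -
  define C where "C = nat \<lceil>K\<rceil>"
  define I where "I s \<longleftrightarrow> heavy_ball_epoch g \<eta> \<theta> (iter s) (idx s) \<and> idx s \<le> C \<and>
     real (idx s) * path_energy (iter s) (idx s) \<le> B\<^sup>2 \<and>
     (\<exists>N. f (iter s 0) + real N * \<delta> \<le> f xint \<and> grads s \<le> N * C + idx s)"
    for s :: "'a rhb_state"
  have start: "I (rhb_start xint 0)"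
    by (auto simp: I_def rhb_start_def heavy_ball_epoch_def intro!: exI[of _ 0])
  have step: "I (rhb_step g \<eta> B \<theta> s)" if s: "I s" and run: "real (idx s) < K" for s
  proof -
    define n where "n = Suc (idx s)"
    define x where "x = (iter s)(int (idx s) + 1 := iter s (int (idx s))
      - \<eta> *\<^sub>R g (iter s (int (idx s)))
      + (1 - \<theta>) *\<^sub>R (iter s (int (idx s)) - iter s (int (idx s) - 1)))"
    have n_le: "n \<le> C" using run unfolding n_def C_def by linarith
    have epoch: "heavy_ball_epoch g \<eta> \<theta> x n"
      unfolding x_def n_def using s by (intro heavy_ball_epoch_extend) (simp add: I_def)
    have x0: "x 0 = iter s 0" by (simp add: x_def)
    have prev: "path_energy x (n - 1) = path_energy (iter s) (idx s)"
      unfolding n_def by (simp, intro path_energy_cong) (auto simp: x_def)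
    obtain N where N: "f (iter s 0) + real N * \<delta> \<le> f xint" "grads s \<le> N * C + idx s"
      using s by (auto simp: I_def)
    have eq: "rhb_step g \<eta> B \<theta> s = (if B\<^sup>2 < real n * path_energy x n
        then rhb_start (restart_point \<theta> x n) (grads s + 1)
        else \<lparr>iter = x, idx = n, grads = grads s + 1\<rparr>)"
      by (simp add: rhb_step_def Let_def restart_point_def path_energy_def x_def n_def)
    show ?thesis
    proof (cases "B\<^sup>2 < real n * path_energy x n")
      case True
      have "f (restart_point \<theta> x n) \<le> f (x 0) - \<delta>"
        using s by (intro descent epoch True) (use prev n_le in \<open>auto simp: I_def n_def C_def\<close>)
      with N x0 have "f (restart_point \<theta> x n) + real (Suc N) * \<delta> \<le> f xint"
        by (simp add: algebra_simps)
      moreover have "grads s + 1 \<le> Suc N * C" using N n_le by (simp add: n_def)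
      ultimately show ?thesis using True unfolding eq
        by (auto simp: I_def rhb_start_def heavy_ball_epoch_def intro!: exI[of _ "Suc N"])
    next
      case False
      then show ?thesis using N epoch n_le x0 unfolding eq
        by (auto simp: I_def n_def intro!: exI[of _ N])
    qed
  qed
  have N_le: "real N * \<delta> \<le> f xint - b" if "f y + real N * \<delta> \<le> f xint" for N y
    using that bound[of y] by linarith
  \<comment> \<open>An upper bound for the gradient counter, which makes its complement a termination measure.\<close>
  define M where "M = (nat \<lceil>(f xint - b) / \<delta>\<rceil> + 1) * C"
  have grads_le: "grads s \<le> M" if s: "I s" for s
  proof -
    obtain N where N: "f (iter s 0) + real N * \<delta> \<le> f xint" "grads s \<le> N * C + idx s" "idx s \<le> C"
      using s by (auto simp: I_def)
    have "real N \<le> (f xint - b) / \<delta>" using N_le[OF N(1)] delta by (simp add: field_simps)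
    then have "N \<le> nat \<lceil>(f xint - b) / \<delta>\<rceil>" by linarith
    then have "N * C \<le> nat \<lceil>(f xint - b) / \<delta>\<rceil> * C" by (rule mult_le_mono1)
    then show ?thesis using N unfolding M_def distrib_right mult_1 by linarith
  qed
  have "\<exists>s. rhb_nc g \<eta> B \<theta> K xint = Some s"
    unfolding rhb_nc_def
  proof (rule measure_while_option_Some[where P = I and f = "\<lambda>s. M - grads s"])
    fix s assume s: "I s" "real (idx s) < K"
    have "grads (rhb_step g \<eta> B \<theta> s) = Suc (grads s)"
      by (simp add: rhb_step_def Let_def rhb_start_def)
    then show "I (rhb_step g \<eta> B \<theta> s) \<and> M - grads (rhb_step g \<eta> B \<theta> s) < M - grads s"
      using step[OF s] grads_le[OF step[OF s]] by simp
  qed (rule start)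
  then obtain s where s: "rhb_nc g \<eta> B \<theta> K xint = Some s" ..
  have inv: "I s"
    using s start step unfolding rhb_nc_def by (rule while_option_rule[where P = I, rotated])
  have "\<not> real (idx s) < K"
    using s unfolding rhb_nc_def by (rule while_option_stop)
  with inv have idx: "idx s = nat \<lceil>K\<rceil>" unfolding I_def C_def by linarith
  obtain N where "f (iter s 0) + real N * \<delta> \<le> f xint" "grads s \<le> N * C + idx s"
    using inv by (auto simp: I_def)
  with idx inv show ?thesis
    by (intro that[of s N] s N_le) (auto simp: I_def C_def)
qed

section \<open>Parameters and complexity\<close>

text \<open>
  With \<open>a\<close>, \<open>b\<close> the fourth roots of \<open>\<epsilon>\<close>, \<open>\<rho>\<close> and \<open>l\<close> the square root of \<open>L\<close>, all parameters are rational: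
  \<open>\<theta> = 5 a b / l\<close> and \<open>B = a^2 / (2 b^2)\<close>. The identities express everything that the analysis needs in
  terms of \<open>\<theta>\<close>, \<open>B\<close>, \<open>\<eta>\<close>, so that no fractional power appears elsewhere.
\<close>

lemma rhb_parameter_identities:
  fixes L \<rho> \<epsilon> \<eta> B \<theta> :: real
  assumes "0 < L" "0 < \<rho>" "0 < \<epsilon>"
    and "\<eta> = 1 / (4 * L)" "B = sqrt (\<epsilon> / (4 * \<rho>))" "\<theta> = 10 * (\<epsilon> * \<rho> * \<eta>\<^sup>2) powr (1 / 4)"
  shows "0 < B" and "\<theta>\<^sup>2 * B / \<eta> = 50 * \<epsilon>" and "4 * \<rho> * B\<^sup>2 = \<epsilon>"
    and "\<rho> * B * \<eta> = \<theta>\<^sup>2 / 200"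
    and "L powr (1 / 2) * \<rho> powr (1 / 4) / \<epsilon> powr (7 / 4) = 125 * \<eta> / (\<theta> ^ 3 * B\<^sup>2)"
proof -
  define a b l where "a = \<epsilon> powr (1/4)" and "b = \<rho> powr (1/4)" and "l = L powr (1/2)"
  have pos: "0 < a" "0 < b" "0 < l" using assms by (auto simp: a_def b_def l_def)
  have eps: "\<epsilon> = a ^ 4" and rho: "\<rho> = b ^ 4" and L: "L = l\<^sup>2"
    using assms(1-3) by (auto simp: a_def b_def l_def powr_power)
  have eta: "\<eta> = (1 / (2 * l))\<^sup>2" using assms(4) by (simp add: L power2_eq_square)
  have "B = sqrt ((a\<^sup>2 / (2 * b\<^sup>2))\<^sup>2)"
    unfolding assms(5) eps rho by (simp add: power_divide power_mult_distrib flip: power_mult)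
  then have B: "B = a\<^sup>2 / (2 * b\<^sup>2)" by simp
  have root4: "(y ^ 4) powr (1/4) = y" if "0 < y" for y :: real
  proof -
    have "y ^ 4 = y powr 4" using that by simp
    also have "\<dots> powr (1/4) = y" unfolding powr_powr using that by simp
    finally show ?thesis .
  qed
  have "\<epsilon> * \<rho> * \<eta>\<^sup>2 = (a * b / (2 * l)) ^ 4"
    unfolding eps rho eta by (simp add: power_divide power_mult_distrib flip: power_mult)
  also have "\<dots> powr (1/4) = a * b / (2 * l)"
    by (rule root4) (use pos in simp)
  finally have theta: "\<theta> = 5 * a * b / l" using assms(6) by simp
  have eps7: "\<epsilon> powr (7/4) = a ^ 7" using assms(3) by (simp add: a_def powr_power)
  show "0 < B" using pos by (simp add: B)
  show "\<theta>\<^sup>2 * B / \<eta> = 50 * \<epsilon>" "4 * \<rho> * B\<^sup>2 = \<epsilon>" "\<rho> * B * \<eta> = \<theta>\<^sup>2 / 200"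
    using pos unfolding theta B eta eps rho by (auto simp: field_simps eval_nat_numeral)
  show "L powr (1 / 2) * \<rho> powr (1 / 4) / \<epsilon> powr (7 / 4) = 125 * \<eta> / (\<theta> ^ 3 * B\<^sup>2)"
    unfolding eps7 a_def[symmetric] b_def[symmetric] l_def[symmetric] theta B eta
    using pos by (simp add: field_simps eval_nat_numeral)
qed

theorem theorem4:
  fixes f :: "real^'d \<Rightarrow> real"
    and L \<rho> \<epsilon> \<eta> B \<theta> K \<Delta> :: real
    and xint :: "real^'d"
  assumes "twice_differentiable f"
    and "bdd_below (range f)"
    and "L > 0" and "\<rho> > 0"
    and "L-lipschitz_on UNIV (grad f)"
    and "lipschitz_hessian \<rho> f"
    and "\<epsilon> > 0"
    and "\<eta> = 1 / (4 * L)"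
    and "B = sqrt (\<epsilon> / (4 * \<rho>))"
    and "\<theta> = 10 * (\<epsilon> * \<rho> * \<eta>\<^sup>2) powr (1 / 4)"
    and "0 < \<theta>" and "\<theta> \<le> 1 / 10"
    and "K = 1 / \<theta>"
    and "\<Delta> = f xint - (INF x. f x)"
  shows "\<exists>s. rhb_nc (grad f) \<eta> B \<theta> K xint = Some s \<and>
           real (grads s) \<le> max (\<Delta> * L powr (1 / 2) * \<rho> powr (1 / 4) / \<epsilon> powr (7 / 4)) \<lceil>K\<rceil> \<and>
           rhb_outputs K s \<noteq> {} \<and>
           (\<forall>xhat \<in> rhb_outputs K s. norm (grad f xhat) \<le> 242 * \<epsilon>)"
proof -
  let ?g = "grad f"
  note param = rhb_parameter_identities[OF assms(3,4,7,8,9,10)]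
  have eta: "0 < \<eta>" and L: "L = 1 / (4 * \<eta>)" using assms(3,8) by auto
  have K: "10 \<le> K" "K * \<theta> = 1" unfolding assms(13) using assms(11,12) by (auto simp: field_simps)
  \<comment> \<open>Since \<open>K\<close> need not be an integer, an epoch may last \<open>\<lceil>K\<rceil>\<close> steps; this costs at most a factor 11/10 as \<open>K\<close> is at least 10.\<close>
  have C: "K \<le> real (nat \<lceil>K\<rceil>)" "real (nat \<lceil>K\<rceil>) \<le> 11/10 * K"
    using K by linarith+
  have gderiv: "GDERIV f x :> ?g x" for x
    using assms(1) gderiv_grad by (auto simp: twice_differentiable_def)
  have lip: "\<eta> * norm (?g y - ?g z) \<le> norm (y - z) / 4" for y z
    using lipschitz_on_normD[OF assms(5), of y z] eta by (simp add: L field_simps)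
  have smooth: "f (y + v) \<le> f y + ?g y \<bullet> v + (norm v)\<^sup>2 / (4 * \<eta>)" for y v
    using lipschitz_gradient_upper_bound[OF gderiv assms(5), of y v] by (simp add: L)
  have trapezoid: "f (y + v) - f y \<le> (?g y + ?g (y + v)) \<bullet> v / 2 + \<rho> / 2 * norm v ^ 3" for y v
    using trapezoid_rule_error[OF assms(1,6), of y v] assms(4) by linarith
  have small: "\<rho> * B * \<eta> \<le> \<theta> / 20"
  proof -
    have "\<theta> * \<theta> \<le> 10 * \<theta>" using assms(11,12) by (intro mult_right_mono) auto
    then show ?thesis by (simp add: param(4) power2_eq_square)
  qed
  \<comment> \<open>The decrease of an epoch: \<open>\<theta> / (2 \<eta>)\<close> times an energy exceeding \<open>B^2 / n\<close>, where \<open>n\<close> is at most 11/10 times \<open>1 / \<theta>\<close>.\<close>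
  define \<delta> where "\<delta> = 5/11 * \<theta>\<^sup>2 * B\<^sup>2 / \<eta>"
  have delta: "0 < \<delta>" using assms(11) param(1) eta by (simp add: \<delta>_def)
  have descent: "f (restart_point \<theta> x n) \<le> f (x 0) - \<delta>"
    if epoch: "heavy_ball_epoch ?g \<eta> \<theta> x n" and n: "0 < n" "n \<le> nat \<lceil>K\<rceil>"
      and before: "real (n - 1) * path_energy x (n - 1) \<le> B\<^sup>2"
      and after: "B\<^sup>2 < real n * path_energy x n" for x n
  proof -
    interpret heavy_ball ?g \<eta> \<theta> "\<lambda>k. x (int k)" "\<lambda>k. x (int k) - x (int k - 1)" n
      using heavy_ball_epoch_imp_heavy_ball[OF epoch eta assms(11,12)] .
    \<comment> \<open>Steps before the last one are short, as the energy test had not yet triggered.\<close>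
    have short: "norm (x (int k) - x (int k - 1)) \<le> B" if "k < n" for k
    proof (cases k)
      case 0
      then show ?thesis using d_0 param(1) by simp
    next
      case (Suc t)
      let ?e = "\<lambda>t. (norm (x (int t + 1) - x (int t)))\<^sup>2"
      have t: "t < n - 1" using that Suc by simp
      have "?e t \<le> path_energy x (n - 1)"
        unfolding path_energy_def using t by (intro member_le_sum) auto
      also have "\<dots> \<le> real (n - 1) * path_energy x (n - 1)"
        using t mult_right_mono[of 1 "real (n - 1)" "path_energy x (n - 1)"]
        by (simp add: path_energy_def sum_nonneg)
      also note before
      finally have "norm (x (int t + 1) - x (int t)) \<le> B"
        by (rule power2_le_imp_le) (use param(1) in simp)
      then show ?thesis by (simp add: Suc add.commute)
    qed
    have "B\<^sup>2 \<le> (11/10 * K) * path_energy x n"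
    proof -
      have "real n \<le> 11/10 * K" using n C by linarith
      then have "real n * path_energy x n \<le> (11/10 * K) * path_energy x n"
        by (intro mult_right_mono) (auto simp: path_energy_def sum_nonneg)
      with after show ?thesis by simp
    qed
    then have "\<theta> * B\<^sup>2 \<le> \<theta> * ((11/10 * K) * path_energy x n)"
      using assms(11) by (intro mult_left_mono) auto
    also have "\<dots> = 11/10 * path_energy x n" using K(2) by (simp add: mult_ac)
    finally have "\<theta> / (2 * \<eta>) * (10/11 * (\<theta> * B\<^sup>2)) \<le> \<theta> / (2 * \<eta>) * path_energy x n"
      using assms(11) eta by (intro mult_left_mono) auto
    moreover have "\<theta> / (2 * \<eta>) * (10/11 * (\<theta> * B\<^sup>2)) = \<delta>"
      by (simp add: \<delta>_def power2_eq_square mult_ac)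
    moreover have "f (restart_point \<theta> x n) \<le> f (x 0) - \<theta> / (2 * \<eta>) * path_energy x n"
      using epoch_descent[OF lip smooth trapezoid _ small short n(1)] assms(4) n(1)
      by (simp add: restart_point_def path_energy_eq Let_def of_nat_diff)
    ultimately show ?thesis by linarith
  qed
  have inf: "(INF x. f x) \<le> f y" for y using assms(2) by (rule cINF_lower) simp
  obtain s N where s: "rhb_nc ?g \<eta> B \<theta> K xint = Some s"
    and epoch: "heavy_ball_epoch ?g \<eta> \<theta> (iter s) (idx s)" and idx: "idx s = nat \<lceil>K\<rceil>"
    and energy: "real (idx s) * path_energy (iter s) (idx s) \<le> B\<^sup>2"
    and N: "real N * \<delta> \<le> \<Delta>" and grads: "grads s \<le> (N + 1) * nat \<lceil>K\<rceil>"
  proof (rule rhb_nc_epoch_accounting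
      [where g = ?g and \<eta> = \<eta> and B = B and \<theta> = \<theta> and K = K and xint = xint])
    show "f (restart_point \<theta> x n) \<le> f (x 0) - \<delta>"
      if "heavy_ball_epoch ?g \<eta> \<theta> x n" "0 < n" "n \<le> nat \<lceil>K\<rceil>"
        "real (n - 1) * path_energy x (n - 1) \<le> B\<^sup>2" "B\<^sup>2 < real n * path_energy x n" for x n
      using that by (rule descent)
  qed (rule delta inf | use K(1) in linarith | (rule that; simp add: assms(14)))+
  let ?x = "iter s"
  let ?d = "\<lambda>k. ?x (int k) - ?x (int k - 1)"
  interpret heavy_ball ?g \<eta> \<theta> "\<lambda>k. ?x (int k)" ?d "idx s"
    using heavy_ball_epoch_imp_heavy_ball[OF epoch eta assms(11,12)] .
  have budget: "real (idx s) * (\<Sum>t<idx s. (norm (?d (Suc t)))\<^sup>2) \<le> B\<^sup>2"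
    using energy by (simp only: path_energy_eq)
  let ?P = "\<lambda>k. \<lfloor>K / 2\<rfloor> \<le> int k \<and> real k \<le> K - 1"
  have P_eq: "Collect ?P = {nat \<lfloor>K / 2\<rfloor>..<nat \<lfloor>K\<rfloor>}" using K(1) by (auto; linarith)
  have "real (grads s) \<le> max (\<Delta> * L powr (1 / 2) * \<rho> powr (1 / 4) / \<epsilon> powr (7 / 4)) \<lceil>K\<rceil>"
  proof (cases "N = 0")
    case True
    then have "grads s \<le> nat \<lceil>K\<rceil>" using grads by simp
    then have "real (grads s) \<le> \<lceil>K\<rceil>" using K by linarith
    then show ?thesis by simp
  next
    case False
    \<comment> \<open>The last epoch brings no decrease; with at least one restart it is charged to the first epoch.\<close>
    have "real (grads s) \<le> real (N + 1) * real (nat \<lceil>K\<rceil>)"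
      using grads by (metis of_nat_le_iff of_nat_mult)
    also have "\<dots> \<le> (2 * real N) * (11/10 * K)" using False C K by (intro mult_mono) auto
    also have "\<dots> = real N * \<delta> * (2 * (11/10 * K) / \<delta>)" using delta by simp
    also have "\<dots> \<le> \<Delta> * (125 * \<eta> / (\<theta> ^ 3 * B\<^sup>2))"
    proof (intro mult_mono N)
      show "2 * (11/10 * K) / \<delta> \<le> 125 * \<eta> / (\<theta> ^ 3 * B\<^sup>2)"
        using param(1) eta assms(11,13) by (simp add: \<delta>_def field_simps eval_nat_numeral)
      show "0 \<le> \<Delta>" using inf[of xint] assms(14) by simp
    qed (use delta K in auto)
    also have "\<dots> = \<Delta> * L powr (1 / 2) * \<rho> powr (1 / 4) / \<epsilon> powr (7 / 4)"
      by (simp flip: param(5))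
    finally show ?thesis by simp
  qed
  moreover have "rhb_outputs K s \<noteq> {}"
  proof -
    have "nat \<lfloor>K / 2\<rfloor> \<in> Collect ?P" unfolding P_eq using K(1) by simp linarith
    then have "finite (Collect ?P)" "Collect ?P \<noteq> {}" using P_eq by auto
    then obtain j where "is_arg_min (\<lambda>k. norm (?x (int k + 1) - ?x (int k))) (\<lambda>k. k \<in> Collect ?P) j"
      using ex_is_arg_min_if_finite by blast
    then show ?thesis unfolding rhb_outputs_def by auto
  qed
  moreover have "norm (?g xhat) \<le> 242 * \<epsilon>" if out: "xhat \<in> rhb_outputs K s" for xhat
  proof -
    obtain j where xhat: "xhat = (1 / real (j + 1)) *\<^sub>R (\<Sum>k\<le>j. ?x (int k))"
      and j: "is_arg_min (\<lambda>k. norm (?x (int k + 1) - ?x (int k))) ?P j"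
      using out unfolding rhb_outputs_def by auto
    have jP: "\<lfloor>K / 2\<rfloor> \<le> int j" "real j \<le> K - 1"
      and minimal: "\<And>k. ?P k \<Longrightarrow> norm (?x (int j + 1) - ?x (int j)) \<le> norm (?x (int k + 1) - ?x (int k))"
      using j unfolding is_arg_min_linorder by auto
    have j_idx: "j < idx s" using jP C unfolding idx by linarith
    have "norm (\<Sum>k<Suc j. ?g (?x (int k))) / real (Suc j) \<le> 9/2 * \<theta>\<^sup>2 * B / \<eta>"
    proof (rule average_gradient_le[OF budget])
      show "0 \<le> B" "1 / \<theta> \<le> real (idx s)" using param(1) C assms(13) idx by auto
      show "j < idx s" by (rule j_idx)
      have "K / 2 \<le> real (Suc j)" using jP(1) by linarith
      then show "1 / (2 * \<theta>) \<le> real (Suc j)" by (simp add: assms(13))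
      show "Collect ?P \<subseteq> {..<idx s}" unfolding idx using C by (auto; linarith)
      \<comment> \<open>The argmin ranges over \<open>\<lfloor>K\<rfloor> - \<lfloor>K / 2\<rfloor>\<close> indices, at least 9/20 of \<open>K\<close> because \<open>K\<close> is at least 10.\<close>
      define p q where "p = \<lfloor>K\<rfloor>" and "q = \<lfloor>K / 2\<rfloor>"
      have pq: "2 * q \<le> p" "10 \<le> p" "0 \<le> q" and "K < real_of_int p + 1"
        using K(1) unfolding p_def q_def by linarith+
      then have "nat p - nat q = nat (p - q)" by linarith
      then have "real (nat p - nat q) = real_of_int p - real_of_int q" using pq by simp
      moreover have "2 * real_of_int q \<le> real_of_int p" "10 \<le> real_of_int p" using pq by linarith+
      ultimately have "9/20 * K \<le> real (nat p - nat q)"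
        using \<open>K < real_of_int p + 1\<close> by linarith
      then show "9 / (20 * \<theta>) \<le> real (card (Collect ?P))" unfolding P_eq by (simp add: assms(13) p_def q_def)
      show "norm (?d (Suc j)) \<le> norm (?d (Suc k))" if "k \<in> Collect ?P" for k
        using minimal[of k] that by (simp add: add.commute)
    qed
    also have "\<dots> = 9/2 * (\<theta>\<^sup>2 * B / \<eta>)" by simp
    also have "\<dots> = 225 * \<epsilon>" unfolding param(2) by simp
    finally have avg: "norm (\<Sum>k<Suc j. ?g (?x (int k))) / real (Suc j) \<le> 225 * \<epsilon>" .
    have near: "norm (?x (int k) - ?x (int 0)) \<le> B" if "k < Suc j" for k
      by (rule distance_le[OF budget]) (use param(1) that j_idx in auto)
    have "norm (?g xhat) \<le> norm (\<Sum>k<Suc j. ?g (?x (int k))) / real (Suc j) + 4 * \<rho> * B\<^sup>2"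
      using gradient_at_average[where x = "\<lambda>k. ?x (int k)" and m = "Suc j", OF assms(1,6) _ _ near] assms(4)
      by (simp add: xhat lessThan_Suc_atMost)
    with avg param(3) assms(7) show ?thesis by simp
  qed
  ultimately show ?thesis using s by blast
qed

end
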